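(* Let $r>0$ be an integer and let $g\in C^{r+1}[0,1]$ satisfy $g^{(j)}(0)=0$ for $j=0,\dots,r$, $g^{(r+1)}(x)\ne0$ for $x\in[0,1]$, and be monotonically increasing with no inflection point in $[0,1]$; put $\sigma(r):=\max_{x\in[0,1]}|g^{(r+1)}(x)|/(r+1)!$ and $\delta(r):=\min_{x\in[0,1]}|g^{(r+1)}(x)|/(r+1)!$. Let $f\in L^1[0,1]$ be continuous on $(0,1]$, let $\Psi:=(f/g')\circ g^{-1}$ on $(0,g(1)]$ and $\Theta(y):=\Psi(g(1)y)$, $y\in(0,1]$. If $\Theta$ is of $\mathrm{Type}(\alpha,m+1,\{0\})$ for some $\alpha\in(-1,1)$ and some $m\in\mathbb{N}$ with $m\ge2$, then there exists a positive constant $c$ such that for all $\kappa>1$ and all $n\in\mathbb{N}$ satisfying $n\ge\ln\kappa_{\sigma(r)}/\ln2$, $$\left|\mathcal{I}_\kappa^{\Lambda}[f,g]-\mathcal{Q}_{\kappa,n,m}^{\Lambda}[f,g]\right|\le c\,(r+1)\,|g(1)|^{-\alpha}\,(\delta(r))^{\alpha-1}\,\kappa^{-2}\,\kappa_{\sigma(r)}^{1-\alpha}\,\ln\kappa_{\sigma(r)}\,(\beta_n(r))^{m-1},$$ and, for such $\kappa$ and $n$, $\mathcal{N}\big(\mathcal{Q}_{\kappa,n,m}^{\Lambda}[f,g]\big)\le\Big\lceil\big(2(r+1)\sigma(r)/\delta(r)\big)^{m/(m-1)}\Big\rceil nm+1$.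
   Context: $\mathbb{N}=\{1,2,\dots\}$. "No inflection point in $[0,1]$" means that $g'$ is monotone on $[0,1]$. Type. For an integer $k\ge0$, a real-valued $\phi\in C^{k}((0,1])$ is of $\mathrm{Type}(\alpha,k,\{0\})$ if there is a constant $c>0$ with $|\phi^{(k)}(x)|\le c\,x^{\alpha-k}$ for all $x\in(0,1]$. $\kappa_{\sigma(r)}:=\kappa$ if $\sigma(r)\le1$ and $\kappa_{\sigma(r)}:=\kappa\sigma(r)$ if $\sigma(r)>1$; $\lambda_r:=\kappa_{\sigma(r)}^{-1/(r+1)}$; $\Lambda:=[\lambda_r,1]$; $\beta_n(r):=\lambda_r^{-1/n}-1$; $\mathcal{I}_\kappa^{\Lambda}[f,g]:=\int_{\lambda_r}^1f(x)e^{\mathrm{i}\kappa g(x)}\,dx$. Basic Filon-type rule. For $[a,b]\subset(0,1]$ and $m\in\mathbb{N}$, choose (arbitrary) nodes $a=t_0<t_1<\dots<t_m=b$ and let $p_m$ be the polynomial of degree at most $m$ with $p_m(g(t_j))=\Psi(g(t_j))$, $j=0,\dots,m$. Put $\mathcal{Q}^{[a,b]}_{\kappa,m}[f,g]:=\int_{g(a)}^{g(b)}p_m(x)e^{\mathrm{i}\kappa x}\,dx$. For $N\in\mathbb{N}$ let $y_j:=a+(b-a)j/N$, $j=0,\dots,N$, and $\mathcal{Q}^{[a,b]}_{N,\kappa,m}[f,g]:=\sum_{j=1}^{N}\mathcal{Q}^{[y_{j-1},y_j]}_{\kappa,m}[f,g]$. Composite rule on $\Lambda$. Let $x_j:=\kappa_{\sigma(r)}^{(j/n-1)/(r+1)}$,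 $j=0,\dots,n$; for $j=1,\dots,n$ let $M_j:=\max\{|g'(x_{j-1})|,|g'(x_j)|\}$, $q_j:=M_jx_{j-1}/g(x_{j-1})$, $N_j:=\lceil q_j^{m/(m-1)}\rceil$. Then $\mathcal{Q}_{\kappa,n,m}^{\Lambda}[f,g]:=\sum_{j=1}^n\mathcal{Q}^{[x_{j-1},x_j]}_{N_j,\kappa,m}[f,g]$. $\mathcal{N}(F)$ denotes the number of evaluations of $\Psi$ used in the formula $F$ (an evaluation at an endpoint shared by two subintervals is counted once). *)

theory Defs
  imports "HOL-Analysis.Analysis" "HOL-Computational_Algebra.Polynomial"
begin

(* Derivatives are relative to S, hence one-sided at endpoints of S that belong to S.
   On S, only the values of f on S matter. *)
definition nderiv_on :: "real set \<Rightarrow> nat \<Rightarrow> (real \<Rightarrow> real) \<Rightarrow> real \<Rightarrow> real" where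
  "nderiv_on S k f = ((\<lambda>h x. vector_derivative h (at x within S)) ^^ k) f"

definition Ck_on :: "nat \<Rightarrow> real set \<Rightarrow> (real \<Rightarrow> real) \<Rightarrow> bool" where
  "Ck_on k S f \<longleftrightarrow>
     (\<forall>i<k. nderiv_on S i f differentiable_on S) \<and> continuous_on S (nderiv_on S k f)"

(* Type(alpha, k, {0}) *)
definition Type0 :: "real \<Rightarrow> nat \<Rightarrow> (real \<Rightarrow> real) \<Rightarrow> bool" where
  "Type0 \<alpha> k \<phi> \<longleftrightarrow> Ck_on k {0<..1} \<phi> \<and>
     (\<exists>c>0. \<forall>x\<in>{0<..1}. \<bar>nderiv_on {0<..1} k \<phi> x\<bar> \<le> c * x powr (\<alpha> - real k))"

(* For g in C^(r+1)[0,1] the supremum and infimum are attained. *)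
definition sigma_max :: "(real \<Rightarrow> real) \<Rightarrow> nat \<Rightarrow> real" where
  "sigma_max g r = (SUP x\<in>{0..1}. \<bar>nderiv_on {0..1} (r+1) g x\<bar>) / fact (r+1)"

definition delta_min :: "(real \<Rightarrow> real) \<Rightarrow> nat \<Rightarrow> real" where
  "delta_min g r = (INF x\<in>{0..1}. \<bar>nderiv_on {0..1} (r+1) g x\<bar>) / fact (r+1)"

definition kappa_sigma :: "(real \<Rightarrow> real) \<Rightarrow> nat \<Rightarrow> real \<Rightarrow> real" where
  "kappa_sigma g r \<kappa> = (if sigma_max g r \<le> 1 then \<kappa> else \<kappa> * sigma_max g r)"

definition lambda_r :: "(real \<Rightarrow> real) \<Rightarrow> nat \<Rightarrow> real \<Rightarrow> real" where
  "lambda_r g r \<kappa> = kappa_sigma g r \<kappa> powr (- 1 / real (r+1))"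

definition beta_n :: "(real \<Rightarrow> real) \<Rightarrow> nat \<Rightarrow> real \<Rightarrow> nat \<Rightarrow> real" where
  "beta_n g r \<kappa> n = lambda_r g r \<kappa> powr (- 1 / real n) - 1"

definition Psi :: "(real \<Rightarrow> real) \<Rightarrow> (real \<Rightarrow> real) \<Rightarrow> real \<Rightarrow> real" where
  "Psi f g = (\<lambda>x. f x / nderiv_on {0..1} 1 g x) \<circ> inv_into {0..1} g"

definition Theta :: "(real \<Rightarrow> real) \<Rightarrow> (real \<Rightarrow> real) \<Rightarrow> real \<Rightarrow> real" where
  "Theta f g y = Psi f g (g 1 * y)"

definition osc_integral ::
  "(real \<Rightarrow> real) \<Rightarrow> (real \<Rightarrow> real) \<Rightarrow> nat \<Rightarrow> real \<Rightarrow> complex" where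
  "osc_integral f g r \<kappa> =
     integral {lambda_r g r \<kappa>..1} (\<lambda>x. of_real (f x) * exp (\<i> * of_real (\<kappa> * g x)))"

(* A node rule T assigns to every [a,b] contained in (0,1] its nodes
   a = T a b 0 < ... < T a b m = b; the choice is otherwise arbitrary. *)
definition node_rule :: "nat \<Rightarrow> (real \<Rightarrow> real \<Rightarrow> nat \<Rightarrow> real) \<Rightarrow> bool" where
  "node_rule m T \<longleftrightarrow> (\<forall>a b. 0 < a \<longrightarrow> a < b \<longrightarrow> b \<le> 1 \<longrightarrow>
     T a b 0 = a \<and> T a b m = b \<and> (\<forall>j<m. T a b j < T a b (Suc j)))"

definition interp_poly :: "nat \<Rightarrow> (nat \<Rightarrow> real) \<Rightarrow> (real \<Rightarrow> real) \<Rightarrow> real poly" where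
  "interp_poly m s \<phi> =
     (THE p. degree p \<le> m \<and> (\<forall>j\<le>m. poly p (s j) = \<phi> (s j)))"

definition filon ::
  "(real \<Rightarrow> real) \<Rightarrow> (real \<Rightarrow> real) \<Rightarrow> (real \<Rightarrow> real \<Rightarrow> nat \<Rightarrow> real) \<Rightarrow>
   real \<Rightarrow> nat \<Rightarrow> real \<Rightarrow> real \<Rightarrow> complex" where
  "filon f g T \<kappa> m a b =
     (let p = interp_poly m (\<lambda>j. g (T a b j)) (Psi f g)
      in integral {g a..g b} (\<lambda>x. of_real (poly p x) * exp (\<i> * of_real (\<kappa> * x))))"

definition equi_pt :: "nat \<Rightarrow> real \<Rightarrow> real \<Rightarrow> nat \<Rightarrow> real" where
  "equi_pt N a b j = a + (b - a) * real j / real N"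

definition filon_equi ::
  "(real \<Rightarrow> real) \<Rightarrow> (real \<Rightarrow> real) \<Rightarrow> (real \<Rightarrow> real \<Rightarrow> nat \<Rightarrow> real) \<Rightarrow>
   nat \<Rightarrow> real \<Rightarrow> nat \<Rightarrow> real \<Rightarrow> real \<Rightarrow> complex" where
  "filon_equi f g T N \<kappa> m a b =
     (\<Sum>j=1..N. filon f g T \<kappa> m (equi_pt N a b (j - 1)) (equi_pt N a b j))"

definition mesh_pt :: "(real \<Rightarrow> real) \<Rightarrow> nat \<Rightarrow> real \<Rightarrow> nat \<Rightarrow> nat \<Rightarrow> real" where
  "mesh_pt g r \<kappa> n j =
     kappa_sigma g r \<kappa> powr ((real j / real n - 1) / real (r+1))"

definition mesh_M :: "(real \<Rightarrow> real) \<Rightarrow> nat \<Rightarrow> real \<Rightarrow> nat \<Rightarrow> nat \<Rightarrow> real" where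
  "mesh_M g r \<kappa> n j =
     max \<bar>nderiv_on {0..1} 1 g (mesh_pt g r \<kappa> n (j - 1))\<bar>
         \<bar>nderiv_on {0..1} 1 g (mesh_pt g r \<kappa> n j)\<bar>"

definition mesh_q :: "(real \<Rightarrow> real) \<Rightarrow> nat \<Rightarrow> real \<Rightarrow> nat \<Rightarrow> nat \<Rightarrow> real" where
  "mesh_q g r \<kappa> n j =
     mesh_M g r \<kappa> n j * mesh_pt g r \<kappa> n (j - 1) / g (mesh_pt g r \<kappa> n (j - 1))"

definition mesh_N :: "(real \<Rightarrow> real) \<Rightarrow> nat \<Rightarrow> real \<Rightarrow> nat \<Rightarrow> nat \<Rightarrow> nat \<Rightarrow> nat" where
  "mesh_N g r \<kappa> n m j = nat \<lceil>mesh_q g r \<kappa> n j powr (real m / (real m - 1))\<rceil>"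

definition filon_Lambda ::
  "(real \<Rightarrow> real) \<Rightarrow> (real \<Rightarrow> real) \<Rightarrow> (real \<Rightarrow> real \<Rightarrow> nat \<Rightarrow> real) \<Rightarrow>
   nat \<Rightarrow> real \<Rightarrow> nat \<Rightarrow> nat \<Rightarrow> complex" where
  "filon_Lambda f g T r \<kappa> n m =
     (\<Sum>j=1..n. filon_equi f g T (mesh_N g r \<kappa> n m j) \<kappa> m
        (mesh_pt g r \<kappa> n (j - 1)) (mesh_pt g r \<kappa> n j))"

(* The points at which filon_Lambda evaluates Psi. Being a set, it contains an endpoint
   shared by two subintervals only once; its cardinality is the number of evaluations. *)
definition eval_points ::
  "(real \<Rightarrow> real) \<Rightarrow> (real \<Rightarrow> real \<Rightarrow> nat \<Rightarrow> real) \<Rightarrow> nat \<Rightarrow> real \<Rightarrow> nat \<Rightarrow> nat \<Rightarrow> real set" where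
  "eval_points g T r \<kappa> n m =
     (\<Union>j\<in>{1..n}.
        let N = mesh_N g r \<kappa> n m j; a = mesh_pt g r \<kappa> n (j - 1); b = mesh_pt g r \<kappa> n j
        in \<Union>i\<in>{1..N}. (\<lambda>l. g (T (equi_pt N a b (i - 1)) (equi_pt N a b i) l)) ` {0..m})"

definition num_evals ::
  "(real \<Rightarrow> real) \<Rightarrow> (real \<Rightarrow> real \<Rightarrow> nat \<Rightarrow> real) \<Rightarrow> nat \<Rightarrow> real \<Rightarrow> nat \<Rightarrow> nat \<Rightarrow> nat" where
  "num_evals g T r \<kappa> n m = card (eval_points g T r \<kappa> n m)"

end

theory Submission
  imports Defs
begin

text \<open>
  Substituting \<open>x = g(t)\<close> turns the error on one cell into the oscillatory integral of the
  interpolation error \<open>e = \<Psi> - p\<close>. Since \<open>e\<close> vanishes at both endpoints, two integrations by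
  parts gain a factor \<open>\<kappa>\<^sup>-\<^sup>2\<close>, leaving only \<open>e'\<close> and \<open>e''\<close>; by Rolle each derivative of \<open>e\<close> up to
  order \<open>m\<close> has a zero in the cell, so \<open>|e\<^sup>(\<^sup>k\<^sup>)| \<le> h\<^sup>m\<^sup>+\<^sup>1\<^sup>-\<^sup>k sup |\<Psi>\<^sup>(\<^sup>m\<^sup>+\<^sup>1\<^sup>)|\<close>, where \<open>h\<close> is the length of the
  cell after the substitution.
  The choice of \<open>N\<^sub>j\<close> makes \<open>N\<^sub>j (q\<^sub>j / N\<^sub>j)\<^sup>m \<le> 1\<close>, so every mesh interval contributes the same bound,
  and \<open>n \<beta>\<^sub>n \<le> 2 ln \<kappa>\<^sub>\<sigma>\<close>. Taylor's bounds \<open>\<delta> x\<^sup>r\<^sup>+\<^sup>1 \<le> g(x)\<close> and \<open>g'(x) \<le> (r + 1) \<sigma> x\<^sup>r\<close> control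
  \<open>g(x\<^sub>j)\<^sup>\<alpha>\<^sup>-\<^sup>1\<close> and \<open>q\<^sub>j\<close>.
\<close>

subsection \<open>Zeros of derivatives and interpolation\<close>

lemma nderiv_on_0: "nderiv_on S 0 f = f"
  by (simp add: nderiv_on_def)

lemma nderiv_on_has_deriv:
  assumes "Ck_on k S f" "i < k" "x \<in> S"
  shows "(nderiv_on S i f has_real_derivative nderiv_on S (Suc i) f x) (at x within S)"
proof -
  have "nderiv_on S i f differentiable (at x within S)"
    using assms by (auto simp: Ck_on_def differentiable_on_def)
  then have "(nderiv_on S i f has_vector_derivative
      vector_derivative (nderiv_on S i f) (at x within S)) (at x within S)"
    by (simp add: vector_derivative_works)
  then show ?thesis
    by (simp add: has_real_derivative_iff_has_vector_derivative nderiv_on_def)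
qed

lemma mvt_within:
  fixes f f' :: "real \<Rightarrow> real"
  assumes "a < b"
    and "\<And>x. a \<le> x \<Longrightarrow> x \<le> b \<Longrightarrow> (f has_real_derivative f' x) (at x within {a..b})"
  obtains z where "a < z" "z < b" "f b - f a = f' z * (b - a)"
proof -
  have "\<exists>x\<in>{a<..<b}. f b - f a = (\<lambda>v. f' x * v) (b - a)"
    using assms by (intro mvt_simple) (auto simp: has_field_derivative_def)
  then show ?thesis using that by auto
qed

lemma Suc_chain_less:
  fixes s :: "nat \<Rightarrow> real"
  assumes "\<And>j. j < m \<Longrightarrow> s j < s (Suc j)" "i < j" "j \<le> m"
  shows "s i < s j"
  using assms(2,3)
proof (induction j)
  case (Suc j)
  then show ?case using assms(1)[of j] by (cases "i = j") fastforce+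
qed simp

text \<open>Rolle between consecutive zeros of \<open>D k\<close> gives one zero of
  \<open>D (Suc k)\<close> in each open gap. The gaps are disjoint and ordered, so the new zeros are
  again strictly increasing. Each differentiation loses one zero, and \<open>m + 1\<close> initial
  zeros leave one for \<open>k = m\<close>.\<close>

lemma rolle_chain:
  fixes D :: "nat \<Rightarrow> real \<Rightarrow> real"
  assumes der: "\<And>k x. k \<le> m \<Longrightarrow> a \<le> x \<Longrightarrow> x \<le> b \<Longrightarrow>
      (D k has_real_derivative D (Suc k) x) (at x within {a..b})"
    and "\<And>j. j < m \<Longrightarrow> s j < s (Suc j)"
    and "\<And>j. j \<le> m \<Longrightarrow> s j \<in> {a..b} \<and> D 0 (s j) = 0"
    and "k \<le> m"
  shows "\<exists>z. (\<forall>j<m - k. z j < z (Suc j)) \<and> (\<forall>j\<le>m - k. z j \<in> {a..b} \<and> D k (z j) = 0)"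
  using assms(4)
proof (induction k)
  case 0
  show ?case using assms(2,3) by auto
next
  case (Suc k)
  then obtain z where z: "\<And>j. j < m - k \<Longrightarrow> z j < z (Suc j)"
      "\<And>j. j \<le> m - k \<Longrightarrow> z j \<in> {a..b} \<and> D k (z j) = 0"
    by auto
  have "\<exists>w. z j < w \<and> w < z (Suc j) \<and> D (Suc k) w = 0" if "j < m - k" for j
  proof -
    have in_ab: "a \<le> z j" "z (Suc j) \<le> b" and zeros: "D k (z j) = 0" "D k (z (Suc j)) = 0"
      using z(2)[of j] z(2)[of "Suc j"] that by auto
    have "(D k has_real_derivative D (Suc k) x) (at x within {z j..z (Suc j)})"
      if "z j \<le> x" "x \<le> z (Suc j)" for x
      by (rule DERIV_subset[OF der]) (use that in_ab Suc.prems in auto)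
    with z(1)[OF that] obtain w where "z j < w" "w < z (Suc j)"
        "D k (z (Suc j)) - D k (z j) = D (Suc k) w * (z (Suc j) - z j)"
      using mvt_within by blast
    with zeros show ?thesis by auto
  qed
  then obtain w where w: "\<And>j. j < m - k \<Longrightarrow> z j < w j \<and> w j < z (Suc j) \<and> D (Suc k) (w j) = 0"
    by metis
  have "w j < w (Suc j)" if "j < m - Suc k" for j
    using w[of j] w[of "Suc j"] that by (force simp: less_diff_conv)
  moreover have "w j \<in> {a..b} \<and> D (Suc k) (w j) = 0" if "j \<le> m - Suc k" for j
    using w[of j] z(2)[of j] z(2)[of "Suc j"] that Suc.prems by (force simp: Suc_diff_Suc)
  ultimately show ?case by auto
qed

text \<open>Downward induction from the top derivative. For \<open>k \<le> m\<close>,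
  \<open>D k\<close> has a zero somewhere in the interval, and moving from that zero to
  \<open>x\<close> costs one factor \<open>b - a\<close> by the mean value inequality.\<close>

lemma deriv_bound_of_zeros:
  fixes D :: "nat \<Rightarrow> real \<Rightarrow> real"
  assumes der: "\<And>k x. k \<le> m \<Longrightarrow> a \<le> x \<Longrightarrow> x \<le> b \<Longrightarrow>
      (D k has_real_derivative D (Suc k) x) (at x within {a..b})"
    and "\<And>j. j < m \<Longrightarrow> s j < s (Suc j)"
    and "\<And>j. j \<le> m \<Longrightarrow> s j \<in> {a..b} \<and> D 0 (s j) = 0"
    and bd: "\<And>x. a \<le> x \<Longrightarrow> x \<le> b \<Longrightarrow> \<bar>D (Suc m) x\<bar> \<le> M"
    and "k \<le> Suc m" and "a \<le> x" "x \<le> b"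
  shows "\<bar>D k x\<bar> \<le> M * (b - a) ^ (Suc m - k)"
  using assms(5-7)
proof (induction k arbitrary: x rule: inc_induct)
  case base
  then show ?case using bd by simp
next
  case (step k)
  have km: "k \<le> m" using step.hyps by simp
  obtain z where "\<forall>j\<le>m - k. z j \<in> {a..b} \<and> D k (z j) = 0"
    using rolle_chain[of m a b D s, OF der assms(2,3) km] by blast
  then have z0: "z 0 \<in> {a..b}" "D k (z 0) = 0" by auto
  have bds: "\<bar>D (Suc k) y\<bar> \<le> M * (b - a) ^ (m - k)" if "y \<in> {a..b}" for y
    using step.IH[of y] that by simp
  have "\<bar>D k x - D k (z 0)\<bar> \<le> M * (b - a) ^ (m - k) * \<bar>x - z 0\<bar>"
    using field_differentiable_bound[of "{a..b}" "D k" "D (Suc k)" "M * (b - a) ^ (m - k)" x "z 0"]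
      der[OF km] bds step.prems z0 by auto
  also have "\<dots> \<le> M * (b - a) ^ (m - k) * (b - a)"
    using z0 step.prems bds[of x] by (intro mult_left_mono) auto
  finally show ?case using z0 km by (simp add: Suc_diff_le mult_ac)
qed

text \<open>Newton's incremental construction: \<open>w\<close> vanishes at all earlier nodes but
  not at the new one, so a suitable multiple of it corrects the value there and leaves the others
  unchanged.\<close>

lemma interpolation_exists:
  fixes s :: "nat \<Rightarrow> real"
  assumes "inj_on s {..m}"
  shows "\<exists>p. degree p \<le> m \<and> (\<forall>j\<le>m. poly p (s j) = \<phi> (s j))"
  using assms
proof (induction m)
  case 0
  show ?case by (intro exI[of _ "[:\<phi> (s 0):]"]) simp
next
  case (Suc m)
  then obtain p where p: "degree p \<le> m" "\<And>j. j \<le> m \<Longrightarrow> poly p (s j) = \<phi> (s j)"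
    by (metis atMost_Suc_eq_insert_0 inj_on_subset atMost_subset_iff le_SucI order_refl)
  define w where "w = (\<Prod>j\<le>m. [:- s j, 1:])"
  have ev: "poly w x = (\<Prod>j\<le>m. x - s j)" for x
    by (simp add: w_def poly_prod)
  have "s (Suc m) \<noteq> s j" if "j \<le> m" for j
    using inj_onD[OF Suc.prems, of "Suc m" j] that by auto
  then have "poly w (s (Suc m)) \<noteq> 0"
    by (auto simp: ev)
  moreover have "poly w (s j) = 0" if "j \<le> m" for j
    using that by (auto simp: ev)
  moreover have "degree w \<le> Suc m"
    unfolding w_def by (rule order_trans[OF degree_prod_sum_le]) auto
  ultimately show ?case
  proof (intro exI conjI allI impI)
    let ?p = "p + smult ((\<phi> (s (Suc m)) - poly p (s (Suc m))) / poly w (s (Suc m))) w"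
    show "degree ?p \<le> Suc m"
      using p(1) \<open>degree w \<le> Suc m\<close>
      by (intro degree_add_le order_trans[OF degree_smult_le]) auto
    show "poly ?p (s j) = \<phi> (s j)" if "j \<le> Suc m" for j
      using that p(2) \<open>poly w (s (Suc m)) \<noteq> 0\<close> \<open>\<And>j. j \<le> m \<Longrightarrow> poly w (s j) = 0\<close>
      by (auto simp: le_Suc_eq)
  qed
qed

text \<open>Justifies the \<open>THE\<close> in the definition: two polynomials of degree at most
  \<open>m\<close> that agree at the \<open>m + 1\<close> distinct nodes coincide.\<close>

lemma interp_poly:
  fixes s :: "nat \<Rightarrow> real"
  assumes "inj_on s {..m}"
  shows "degree (interp_poly m s \<phi>) \<le> m"
    and "j \<le> m \<Longrightarrow> poly (interp_poly m s \<phi>) (s j) = \<phi> (s j)"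
proof -
  have card: "card (s ` {..m}) = Suc m" using assms by (simp add: card_image)
  have "\<exists>!p. degree p \<le> m \<and> (\<forall>j\<le>m. poly p (s j) = \<phi> (s j))"
    by (rule ex_ex1I[OF interpolation_exists[OF assms]])
      (rule poly_eqI_degree[of "s ` {..m}"], auto simp: card)
  from theI'[OF this]
  show "degree (interp_poly m s \<phi>) \<le> m"
    and "j \<le> m \<Longrightarrow> poly (interp_poly m s \<phi>) (s j) = \<phi> (s j)"
    by (auto simp: interp_poly_def)
qed

lemma higher_pderiv_eq_0: "degree p < k \<Longrightarrow> (pderiv ^^ k) p = (0 :: real poly)"
proof (induction k arbitrary: p)
  case (Suc k)
  show ?case
  proof (cases "degree p = 0")
    case True
    then have "pderiv p = 0" by (simp add: pderiv_eq_0_iff)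
    then show ?thesis by (induction k) (simp_all add: funpow_swap1)
  next
    case False
    then have "degree (pderiv p) < k" using Suc.prems by (simp add: degree_pderiv)
    from Suc.IH[OF this] show ?thesis by (simp add: funpow_swap1)
  qed
qed simp

subsection \<open>Oscillatory quadrature on one interval\<close>

lemma oscillatory_bound:
  fixes E :: "nat \<Rightarrow> real \<Rightarrow> real"
  assumes "a \<le> b" "\<kappa> > 0"
    and der: "\<And>k x. k \<le> 1 \<Longrightarrow> a \<le> x \<Longrightarrow> x \<le> b \<Longrightarrow>
      (E k has_real_derivative E (Suc k) x) (at x within {a..b})"
    and ends: "E 0 a = 0" "E 0 b = 0"
    and b1: "\<And>x. a \<le> x \<Longrightarrow> x \<le> b \<Longrightarrow> \<bar>E 1 x\<bar> \<le> B1"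
    and b2: "\<And>x. a \<le> x \<Longrightarrow> x \<le> b \<Longrightarrow> \<bar>E 2 x\<bar> \<le> B2"
  shows "cmod (integral {a..b} (\<lambda>x. of_real (E 0 x) * exp (\<i> * of_real (\<kappa> * x))))
      \<le> (2 * B1 + B2 * (b - a)) / \<kappa> ^ 2"
proof -
  define e where "e x = exp (\<i> * of_real (\<kappa> * x))" for x
  have e_deriv: "(e has_vector_derivative \<i> * \<kappa> * e x) (at x within {a..b})" for x
    unfolding e_def by (auto intro!: derivative_eq_intros has_vector_derivative_real_field
        simp: algebra_simps)
  have norm_e: "cmod (e x) = 1" for x by (simp add: e_def)
  have E_deriv: "((\<lambda>x. complex_of_real (E k x)) has_vector_derivative of_real (E (Suc k) x))
      (at x within {a..b})" if "k \<le> 1" "x \<in> {a..b}" for k x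
    using der[of k x] that by (intro has_vector_derivative_of_real) (auto simp: has_real_derivative_iff_has_vector_derivative)
  \<comment> \<open>The antiderivative suggested by two integrations by parts. On differentiation
    the two terms containing \<open>E 1\<close> cancel, because 1/(i\<kappa>) = -i/\<kappa>.\<close>
  define F where "F x = of_real (E 0 x) * e x / (\<i> * \<kappa>) + of_real (E 1 x) * e x / \<kappa> ^ 2" for x
  have "(F has_vector_derivative of_real (E 0 x) * e x + of_real (E 2 x) * e x / \<kappa> ^ 2)
      (at x within {a..b})" if "x \<in> {a..b}" for x
  proof -
    have "(F has_vector_derivative
        (of_real (E 0 x) * (\<i> * \<kappa> * e x) + of_real (E (Suc 0) x) * e x) / (\<i> * \<kappa>)
        + (of_real (E 1 x) * (\<i> * \<kappa> * e x) + of_real (E (Suc 1) x) * e x) / \<kappa> ^ 2) (at x within {a..b})"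
      unfolding F_def
      by (intro has_vector_derivative_add has_vector_derivative_divide has_vector_derivative_mult
          e_deriv E_deriv that) auto
    then show ?thesis
      by (rule has_vector_derivative_eq_rhs)
        (use \<open>\<kappa> > 0\<close> in \<open>simp add: field_simps power2_eq_square numeral_2_eq_2\<close>)
  qed
  then have F: "((\<lambda>x. of_real (E 0 x) * e x + of_real (E 2 x) * e x / \<kappa> ^ 2)
      has_integral (F b - F a)) {a..b}"
    by (intro fundamental_theorem_of_calculus assms)
  \<comment> \<open>\<open>E 2\<close> is only bounded, not assumed continuous. The integral
    \<open>J\<close> exists by continuity of \<open>E 0\<close>, and the term with
    \<open>E 2\<close> is then integrable as a difference of two integrable functions.\<close>
  have "continuous_on {a..b} (\<lambda>x. of_real (E 0 x) * e x)"
    by (intro continuous_on_mult continuous_on_of_real)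
      (use der[of 0] in \<open>auto simp: e_def intro!: continuous_intros DERIV_continuous_on\<close>)
  then obtain J where J: "((\<lambda>x. of_real (E 0 x) * e x) has_integral J) {a..b}"
    using integrable_continuous_interval by blast
  have "((\<lambda>x. of_real (E 2 x) * e x / \<kappa> ^ 2) has_integral (F b - F a - J)) {a..b}"
    using has_integral_diff[OF F J] by simp
  moreover have "0 \<le> B2" using b2[of a] assms(1) by auto
  ultimately have "cmod (F b - F a - J) \<le> B2 / \<kappa> ^ 2 * (b - a)"
    using has_integral_bound_real[of "B2 / \<kappa> ^ 2" "{}" "\<lambda>x. of_real (E 2 x) * e x / \<kappa> ^ 2" "F b - F a - J" a b] assms(1) b2
    by (auto simp: norm_e norm_mult norm_divide norm_power divide_right_mono)
  \<comment> \<open>Since \<open>E 0\<close> vanishes at both ends, the boundary terms of order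
    1/\<kappa> drop out and only those of order 1/\<kappa>^2 remain.\<close>
  moreover have "cmod (F x) \<le> B1 / \<kappa> ^ 2" if "x = a \<or> x = b" for x
    using that ends b1[of x] assms(1)
    by (auto simp: F_def norm_e norm_mult norm_divide norm_power divide_right_mono)
  then have "cmod (F a) \<le> B1 / \<kappa> ^ 2" "cmod (F b) \<le> B1 / \<kappa> ^ 2" by auto
  moreover have "cmod J \<le> cmod (F b) + cmod (F a) + cmod (F b - F a - J)"
    using norm_triangle_ineq4[of "F b - F a" "F b - F a - J"] norm_triangle_ineq4[of "F b" "F a"]
    by simp
  ultimately have "cmod J \<le> (2 * B1 + B2 * (b - a)) / \<kappa> ^ 2"
    by (simp add: add_divide_distrib)
  then show ?thesis using J unfolding e_def by (simp add: integral_unique)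
qed

lemma interpolatory_quadrature_error:
  fixes P :: "nat \<Rightarrow> real \<Rightarrow> real"
  assumes "a \<le> b" "\<kappa> > 0" "m \<ge> 2"
    and der: "\<And>k x. k \<le> m \<Longrightarrow> a \<le> x \<Longrightarrow> x \<le> b \<Longrightarrow>
      (P k has_real_derivative P (Suc k) x) (at x within {a..b})"
    and bd: "\<And>x. a \<le> x \<Longrightarrow> x \<le> b \<Longrightarrow> \<bar>P (Suc m) x\<bar> \<le> M"
    and s: "s 0 = a" "s m = b" "\<And>j. j < m \<Longrightarrow> s j < s (Suc j)"
  shows "cmod (integral {a..b} (\<lambda>x. of_real (P 0 x) * exp (\<i> * of_real (\<kappa> * x)))
      - integral {a..b} (\<lambda>x. of_real (poly (interp_poly m s (P 0)) x) * exp (\<i> * of_real (\<kappa> * x))))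
      \<le> 3 * M * (b - a) ^ m / \<kappa> ^ 2"
proof -
  define p where "p = interp_poly m s (P 0)"
  define D where "D k x = P k x - poly ((pderiv ^^ k) p) x" for k x
  have mono: "s i \<le> s j" if "i \<le> j" "j \<le> m" for i j
    using Suc_chain_less[of m s i j] s(3) that by (cases "i = j") auto
  have "inj_on s {..m}"
    by (rule linorder_inj_onI) (use Suc_chain_less[of m s] s(3) in force)+
  note p = interp_poly[OF this, where \<phi> = "P 0", folded p_def]
  have derD: "(D k has_real_derivative D (Suc k) x) (at x within {a..b})"
    if "k \<le> m" "a \<le> x" "x \<le> b" for k x
    unfolding D_def using der[OF that] by (auto intro!: derivative_eq_intros poly_DERIV[THEN DERIV_subset])
  have zerosD: "s j \<in> {a..b} \<and> D 0 (s j) = 0" if "j \<le> m" for j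
    using p(2)[OF that] mono[of 0 j] mono[of j m] that s by (auto simp: D_def)
  \<comment> \<open>The interpolant disappears from the top derivative of the error, so the bound
    \<open>M\<close> for \<open>P (Suc m)\<close> applies to \<open>D (Suc m)\<close>.\<close>
  have "(pderiv ^^ Suc m) p = 0"
    using p(1) by (intro higher_pderiv_eq_0) simp
  then have "\<bar>D (Suc m) x\<bar> \<le> M" if "a \<le> x" "x \<le> b" for x
    using bd[OF that] unfolding D_def by simp
  note D_bound = deriv_bound_of_zeros[of m a b D s, OF derD s(3) zerosD this]
  \<comment> \<open>The two boundary terms and the remaining integral each contribute at most M (b -
    a)^m / \<kappa>^2; this is the constant 3.\<close>
  have "cmod (integral {a..b} (\<lambda>x. of_real (D 0 x) * exp (\<i> * of_real (\<kappa> * x))))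
      \<le> (2 * (M * (b - a) ^ m) + M * (b - a) ^ (m - 1) * (b - a)) / \<kappa> ^ 2"
    using D_bound[of 1] D_bound[of 2] derD \<open>m \<ge> 2\<close> zerosD[of 0] zerosD[of m] s assms(1,2)
    by (intro oscillatory_bound) (auto simp: numeral_2_eq_2)
  also have "\<dots> = 3 * M * (b - a) ^ m / \<kappa> ^ 2"
    using \<open>m \<ge> 2\<close> by (simp add: power_eq_if mult_ac)
  also have "integral {a..b} (\<lambda>x. of_real (D 0 x) * exp (\<i> * of_real (\<kappa> * x)))
      = integral {a..b} (\<lambda>x. of_real (P 0 x) * exp (\<i> * of_real (\<kappa> * x)))
      - integral {a..b} (\<lambda>x. of_real (poly p x) * exp (\<i> * of_real (\<kappa> * x)))"
  proof -
    have "continuous_on {a..b} (P 0)" using der[of 0] by (auto intro!: DERIV_continuous_on)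
    then show ?thesis
      by (subst integral_diff[symmetric])
        (auto simp: D_def algebra_simps intro!: integrable_continuous_interval continuous_intros)
  qed
  finally show ?thesis by (simp add: p_def)
qed

section \<open>Counting points and splitting integrals along a chain of subintervals\<close>

lemma card_UN_chain:
  fixes U :: "nat \<Rightarrow> 'a set"
  assumes "\<And>i. 1 \<le> i \<Longrightarrow> i \<le> N \<Longrightarrow> finite (U i) \<and> card (U i) \<le> w i + 1"
    and "\<And>i. 1 \<le> i \<Longrightarrow> i < N \<Longrightarrow> U i \<inter> U (Suc i) \<noteq> {}"
  shows "card (\<Union>i\<in>{1..N}. U i) \<le> (\<Sum>i=1..N. w i) + 1"
  using assms
proof (induction N)
  case (Suc N)
  let ?V = "\<Union>i\<in>{1..N}. U i"
  have split: "(\<Union>i\<in>{1..Suc N}. U i) = ?V \<union> U (Suc N)"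
    by (auto simp: atLeastAtMostSuc_conv)
  have fin: "finite ?V" "finite (U (Suc N))" "card (U (Suc N)) \<le> w (Suc N) + 1"
    using Suc.prems(1) by auto
  show ?case
  proof (cases "N = 0")
    case False
    then have "U N \<inter> U (Suc N) \<noteq> {}" using Suc.prems(2)[of N] by auto
    then have "?V \<inter> U (Suc N) \<noteq> {}" using False by force
    \<comment> \<open>The point shared with \<open>U N\<close> has been counted already, so
      adjoining \<open>U (Suc N)\<close> adds at most \<open>w (Suc N)\<close> new points.\<close>
    then have "card (?V \<inter> U (Suc N)) \<ge> 1" using fin by (simp add: Suc_le_eq card_gt_0_iff)
    moreover have "card ?V \<le> (\<Sum>i=1..N. w i) + 1"
      by (rule Suc.IH) (use Suc.prems in auto)
    ultimately show ?thesis
      using card_Un_Int[OF fin(1,2)] fin(3) unfolding split by simp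
  qed (use fin in simp)
qed simp

lemma integral_sum_mesh:
  fixes h :: "real \<Rightarrow> complex" and z :: "nat \<Rightarrow> real"
  assumes "h integrable_on {z 0..z n}" "\<And>j. j < n \<Longrightarrow> z j \<le> z (Suc j)"
  shows "integral {z 0..z n} h = (\<Sum>j=1..n. integral {z (j - 1)..z j} h)"
  using assms
proof (induction n)
  case (Suc n)
  note mesh = Suc.prems(2)
  have "z 0 \<le> z k" if "k \<le> n" for k
    using that
  proof (induction k)
    case (Suc k)
    then show ?case using mesh[of k] by simp
  qed simp
  then have "z 0 \<le> z n" by simp
  moreover have "h integrable_on {z 0..z n}"
    by (rule integrable_subinterval_real[OF Suc.prems(1)]) (use Suc.prems(2)[of n] in auto)
  ultimately show ?case
    using Suc.IH Suc.prems Henstock_Kurzweil_Integration.integral_combine[of "z 0" "z n" "z (Suc n)" h]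
    by simp
qed simp

subsection \<open>Phases with a stationary point of order r\<close>

text \<open>Downward induction on \<open>k\<close>: the difference \<open>h\<close> of
  \<open>D k\<close> and its monomial vanishes at 0, and its derivative \<open>h'\<close> is the
  same difference one level up, which is nonnegative by induction. The sign of \<open>c\<close> is
  arbitrary, so applying the lemma to the negated derivatives yields upper bounds.\<close>

lemma taylor_lower_bound:
  fixes D :: "nat \<Rightarrow> real \<Rightarrow> real"
  assumes der: "\<And>k x. k < n \<Longrightarrow> x \<in> {0..1} \<Longrightarrow>
      (D k has_real_derivative D (Suc k) x) (at x within {0..1})"
    and zero: "\<And>k. k < n \<Longrightarrow> D k 0 = 0"
    and bd: "\<And>x. x \<in> {0..1} \<Longrightarrow> c \<le> D n x"
    and "k \<le> n" "x \<in> {0..1}"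
  shows "c * x ^ (n - k) / fact (n - k) \<le> D k x"
  using assms(4,5)
proof (induction k arbitrary: x rule: inc_induct)
  case base
  then show ?case using bd by simp
next
  case (step k)
  define h where "h y = D k y - c * y ^ (n - k) / fact (n - k)" for y
  define h' where "h' y = D (Suc k) y - c * y ^ (n - Suc k) / fact (n - Suc k)" for y
  obtain p where p: "n - k = Suc p" "n - Suc k = p"
    using step.hyps by (metis Suc_diff_Suc)
  have h_deriv: "(h has_real_derivative h' y) (at y within {0..x})" if "0 \<le> y" "y \<le> x" for y
  proof -
    have "(D k has_real_derivative D (Suc k) y) (at y within {0..x})"
      by (rule DERIV_subset[OF der]) (use step that in auto)
    moreover have "((\<lambda>y. c / fact (Suc p) * y ^ Suc p) has_real_derivative
        c / fact (Suc p) * (real (Suc p) * y ^ p)) (at y within {0..x})"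
      using DERIV_pow[of "Suc p" y "{0..x}"] by (intro DERIV_cmult) simp
    ultimately have "((\<lambda>y. D k y - c / fact (Suc p) * y ^ Suc p) has_real_derivative
        D (Suc k) y - c / fact (Suc p) * (real (Suc p) * y ^ p)) (at y within {0..x})"
      by (rule DERIV_diff)
    moreover have "c / fact (Suc p) * (real (Suc p) * y ^ p) = c * y ^ p / fact p"
      by (simp add: fact_Suc divide_simps del: of_nat_Suc)
    ultimately show ?thesis unfolding h_def h'_def p by simp
  qed
  have h0: "h 0 = 0" using zero[of k] step.hyps p by (simp add: h_def)
  have "0 \<le> h x"
  proof (cases "x = 0")
    case False
    then have "0 < x" using step.prems by simp
    then obtain z where z: "0 < z" "z < x" "h x - h 0 = h' z * (x - 0)"
      using mvt_within[OF _ h_deriv] by blast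
    then have "0 \<le> h' z" using step.IH[of z] step.prems by (simp add: h'_def)
    then show ?thesis using z h0 \<open>0 < x\<close> by simp
  qed (simp add: h0)
  then show ?case by (simp add: h_def)
qed

text \<open>\<open>mono_g\<close> settles the sign of the top derivative. \<open>mono_g'\<close>
  expresses the absence of inflection points and lets endpoint values control \<open>g'\<close> on a
  subinterval.\<close>

locale flat_phase =
  fixes g :: "real \<Rightarrow> real" and r :: nat
  assumes r_pos: "r > 0"
    and smooth: "Ck_on (r+1) {0..1} g"
    and flat: "\<And>j. j \<le> r \<Longrightarrow> nderiv_on {0..1} j g 0 = 0"
    and nondeg: "\<And>x. x \<in> {0..1} \<Longrightarrow> nderiv_on {0..1} (r+1) g x \<noteq> 0"
    and mono_g: "mono_on {0..1} g"
    and mono_g': "mono_on {0..1} (nderiv_on {0..1} 1 g) \<or> antimono_on {0..1} (nderiv_on {0..1} 1 g)"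
begin

abbreviation "g' \<equiv> nderiv_on {0..1} 1 g"
abbreviation "\<sigma> \<equiv> sigma_max g r"
abbreviation "\<delta> \<equiv> delta_min g r"

lemma nderiv_g:
  "k < r + 1 \<Longrightarrow> x \<in> {0..1} \<Longrightarrow>
    (nderiv_on {0..1} k g has_real_derivative nderiv_on {0..1} (Suc k) g x) (at x within {0..1})"
  by (rule nderiv_on_has_deriv[OF smooth])

lemma g_deriv: "x \<in> {0..1} \<Longrightarrow> (g has_real_derivative g' x) (at x within {0..1})"
  using nderiv_g[of 0 x] by (simp add: nderiv_on_0)

text \<open>Continuity on the compact interval makes the supremum and infimum genuine bounds. The
  infimum is attained, hence positive because the top derivative has no zero.\<close>

lemma abs_top_deriv_bounds:
  shows "x \<in> {0..1} \<Longrightarrow> \<delta> * fact (r+1) \<le> \<bar>nderiv_on {0..1} (r+1) g x\<bar>"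
    and "x \<in> {0..1} \<Longrightarrow> \<bar>nderiv_on {0..1} (r+1) g x\<bar> \<le> \<sigma> * fact (r+1)"
    and "0 < \<delta>"
proof -
  let ?h = "\<lambda>x. \<bar>nderiv_on {0..1} (r+1) g x\<bar>"
  have cont: "continuous_on {0..1} ?h"
    using smooth by (auto simp: Ck_on_def intro: continuous_on_rabs)
  have "bounded (?h ` {0..1})"
    by (intro compact_imp_bounded compact_continuous_image cont compact_Icc)
  then have bdd: "bdd_above (?h ` {0..1})" "bdd_below (?h ` {0..1})"
    by (simp_all add: bounded_imp_bdd_above bounded_imp_bdd_below)
  show "\<delta> * fact (r+1) \<le> ?h x" "?h x \<le> \<sigma> * fact (r+1)" if "x \<in> {0..1}"
    using cINF_lower[OF bdd(2) that] cSUP_upper[OF that bdd(1)]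
    by (simp_all add: delta_min_def sigma_max_def)
  obtain x0 where x0: "x0 \<in> {0..1}" "\<And>x. x \<in> {0..1} \<Longrightarrow> ?h x0 \<le> ?h x"
    using continuous_attains_inf[OF compact_Icc _ cont] by auto
  have "?h x0 \<le> (INF x\<in>{0..1}. ?h x)"
    using x0 by (intro cINF_greatest) auto
  moreover have "0 < ?h x0" using nondeg[OF x0(1)] by simp
  ultimately have "0 < (INF x\<in>{0..1}. ?h x)" by linarith
  then show "0 < \<delta>" by (simp add: delta_min_def)
qed

lemmas delta_pos = abs_top_deriv_bounds(3)

lemma top_deriv_pos:
  assumes "x \<in> {0..1}"
  shows "0 < nderiv_on {0..1} (r+1) g x"
proof (rule ccontr)
  \<comment> \<open>Otherwise the top derivative is negative throughout, and Taylor's bound for \<open>-g\<close> gives \<open>g 1 < g 0\<close>.\<close>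
  let ?h = "nderiv_on {0..1} (r+1) g"
  assume "\<not> 0 < ?h x"
  then have neg: "?h x < 0" using nondeg[OF assms] by simp
  have "connected (?h ` {0..1})"
    using smooth by (intro connected_continuous_image) (auto simp: Ck_on_def)
  then have all_neg: "?h y < 0" if "y \<in> {0..1}" for y
    using connectedD_interval[of "?h ` {0..1}" "?h x" "?h y" 0] assms that neg nondeg
    by (metis (no_types, lifting) image_iff less_eq_real_def not_less)
  have der: "((\<lambda>x. - nderiv_on {0..1} k g x) has_real_derivative - nderiv_on {0..1} (Suc k) g y)
      (at y within {0..1})" if "k < r + 1" "y \<in> {0..1}" for k y
    using DERIV_minus[OF nderiv_g[OF that]] .
  have "\<delta> * fact (r+1) * 1 ^ (r + 1 - 0) / fact (r + 1 - 0) \<le> - nderiv_on {0..1} 0 g 1"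
  proof (rule taylor_lower_bound[of "r+1" "\<lambda>k x. - nderiv_on {0..1} k g x", OF der])
    show "- nderiv_on {0..1} k g 0 = 0" if "k < r + 1" for k using flat[of k] that by simp
    show "\<delta> * fact (r+1) \<le> - ?h y" if "y \<in> {0..1}" for y
      using abs_top_deriv_bounds(1)[OF that] all_neg[OF that] by simp
  qed auto
  then have "g 1 \<le> - \<delta>" by (simp add: nderiv_on_0)
  moreover have "g 0 \<le> g 1" using mono_onD[OF mono_g] by simp
  moreover have "g 0 = 0" using flat[of 0] by (simp add: nderiv_on_0)
  ultimately show False using delta_pos by simp
qed

text \<open>Taylor expansion at 0, where all derivatives below order \<open>r + 1\<close> vanish;
  the upper bound is the lower bound for \<open>-g\<close>.\<close>

lemma nderiv_bounds:
  assumes "x \<in> {0..1}" "k \<le> r + 1"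
  shows "\<delta> * fact (r+1) * x ^ (r + 1 - k) / fact (r + 1 - k) \<le> nderiv_on {0..1} k g x"
    and "nderiv_on {0..1} k g x \<le> \<sigma> * fact (r+1) * x ^ (r + 1 - k) / fact (r + 1 - k)"
proof -
  have top: "\<delta> * fact (r+1) \<le> nderiv_on {0..1} (r+1) g y"
    "nderiv_on {0..1} (r+1) g y \<le> \<sigma> * fact (r+1)" if "y \<in> {0..1}" for y
    using abs_top_deriv_bounds(1,2)[OF that] top_deriv_pos[OF that] by auto
  show "\<delta> * fact (r+1) * x ^ (r + 1 - k) / fact (r + 1 - k) \<le> nderiv_on {0..1} k g x"
    by (rule taylor_lower_bound[where n = "r+1" and D = "\<lambda>k. nderiv_on {0..1} k g", OF nderiv_g])
      (use top assms flat in auto)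
  have der: "((\<lambda>x. - nderiv_on {0..1} k g x) has_real_derivative - nderiv_on {0..1} (Suc k) g y)
      (at y within {0..1})" if "k < r + 1" "y \<in> {0..1}" for k y
    using DERIV_minus[OF nderiv_g[OF that]] .
  have "- (\<sigma> * fact (r+1)) * x ^ (r + 1 - k) / fact (r + 1 - k) \<le> - nderiv_on {0..1} k g x"
    by (rule taylor_lower_bound[where n = "r+1" and D = "\<lambda>k x. - nderiv_on {0..1} k g x", OF der])
      (use top assms flat in auto)
  then show "nderiv_on {0..1} k g x \<le> \<sigma> * fact (r+1) * x ^ (r + 1 - k) / fact (r + 1 - k)"
    by simp
qed

lemma g_bounds:
  assumes "x \<in> {0..1}"
  shows "\<delta> * x ^ (r+1) \<le> g x"
  using nderiv_bounds(1)[OF assms, of 0] by (simp add: nderiv_on_0)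

lemma g'_bounds:
  assumes "x \<in> {0..1}"
  shows "real (r+1) * \<delta> * x ^ r \<le> g' x" "g' x \<le> real (r+1) * \<sigma> * x ^ r"
  using nderiv_bounds[OF assms, of 1] by (simp_all add: mult_ac)

lemma g'_pos: "0 < x \<Longrightarrow> x \<le> 1 \<Longrightarrow> 0 < g' x"
  using g'_bounds(1)[of x] delta_pos
  by (smt (verit) atLeastAtMost_iff mult_pos_pos of_nat_0_less_iff zero_less_power add_gr_0 zero_less_one)

lemma g_pos: "0 < x \<Longrightarrow> x \<le> 1 \<Longrightarrow> 0 < g x"
  using g_bounds[of x] delta_pos
  by (smt (verit) atLeastAtMost_iff mult_pos_pos zero_less_power)

lemma sigma_pos: "0 < \<sigma>"
proof -
  have "0 < real (r+1) * \<sigma>" using g'_bounds(2)[of 1] g'_pos[of 1] by simp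
  then show ?thesis by (rule zero_less_mult_pos) simp
qed

lemma g_mvt:
  assumes "0 \<le> a" "a < b" "b \<le> 1"
  obtains z where "a < z" "z < b" "g b - g a = g' z * (b - a)"
proof (rule mvt_within[OF assms(2)])
  show "(g has_real_derivative g' x) (at x within {a..b})" if "a \<le> x" "x \<le> b" for x
    by (rule DERIV_subset[OF g_deriv]) (use that assms in auto)
qed

lemma g_less: "0 \<le> a \<Longrightarrow> a < b \<Longrightarrow> b \<le> 1 \<Longrightarrow> g a < g b"
  using g_mvt[of a b] g'_pos
  by (smt (verit) mult_pos_pos)

lemma inj_g: "inj_on g {0..1}"
  by (rule linorder_inj_onI) (use g_less in force)+

lemma Psi_g: "0 < x \<Longrightarrow> x \<le> 1 \<Longrightarrow> Psi f g (g x) = f x / g' x"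
  by (simp add: Psi_def inv_into_f_f[OF inj_g])

text \<open>A monotone function on an interval is at most the larger of its endpoint values. This is
  why \<open>mesh_M\<close> needs to look only at mesh points.\<close>

lemma g'_le_max:
  assumes "0 \<le> a" "a \<le> z" "z \<le> b" "b \<le> 1"
  shows "g' z \<le> max \<bar>g' a\<bar> \<bar>g' b\<bar>"
  using mono_g'
proof
  assume "mono_on {0..1} g'"
  then have "g' z \<le> g' b" using assms by (auto elim!: monotone_onD)
  then show ?thesis by linarith
next
  assume "antimono_on {0..1} g'"
  then have "g' z \<le> g' a" using assms by (auto elim!: monotone_onD)
  then show ?thesis by linarith
qed

lemma g_diff_le:
  assumes "0 \<le> a" "a \<le> y" "y < y'" "y' \<le> b" "b \<le> 1"
  shows "g y' - g y \<le> max \<bar>g' a\<bar> \<bar>g' b\<bar> * (y' - y)"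
proof -
  obtain z where z: "y < z" "z < y'" "g y' - g y = g' z * (y' - y)"
    using g_mvt[of y y'] assms by auto
  then show ?thesis using g'_le_max[of a z b] assms by (auto intro!: mult_right_mono)
qed

end

subsection \<open>The graded mesh\<close>

lemma equi_pt_0: "equi_pt N a b 0 = a"
  by (simp add: equi_pt_def)

lemma equi_pt_N: "N > 0 \<Longrightarrow> equi_pt N a b N = b"
  by (simp add: equi_pt_def)

lemma equi_pt_diff: "N > 0 \<Longrightarrow> equi_pt N a b (Suc i) - equi_pt N a b i = (b - a) / real N"
  by (simp add: equi_pt_def field_simps)

lemma equi_pt_mono: "a \<le> b \<Longrightarrow> i \<le> j \<Longrightarrow> equi_pt N a b i \<le> equi_pt N a b j"
  by (simp add: equi_pt_def divide_right_mono mult_left_mono)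

locale filon_mesh = flat_phase +
  fixes \<kappa> :: real and n :: nat
  assumes kappa: "1 < \<kappa>" and n_pos: "1 \<le> n"
    and n_ge: "ln (kappa_sigma g r \<kappa>) / ln 2 \<le> real n"
begin

abbreviation "K \<equiv> kappa_sigma g r \<kappa>"
abbreviation "\<beta> \<equiv> beta_n g r \<kappa> n"
abbreviation "X \<equiv> mesh_pt g r \<kappa> n"

lemma K_gt_1: "1 < K"
  using kappa sigma_pos by (auto simp: kappa_sigma_def intro: less_1_mult)

lemma X_pos: "0 < X j"
  using K_gt_1 by (simp add: mesh_pt_def)

lemma X_0: "X 0 = lambda_r g r \<kappa>"
  by (simp add: mesh_pt_def lambda_r_def)

lemma X_n: "X n = 1"
  using n_pos K_gt_1 by (simp add: mesh_pt_def)

lemma one_plus_beta: "1 + \<beta> = K powr (1 / (real n * real (r+1)))"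
  by (simp add: beta_n_def lambda_r_def powr_powr field_simps)

lemma beta_pos: "0 < \<beta>"
proof -
  have "1 < K powr (1 / (real n * real (r+1)))"
    using K_gt_1 n_pos by (intro gr_one_powr) auto
  then show ?thesis using one_plus_beta by linarith
qed

text \<open>The exponents of the mesh points form an arithmetic progression, so the mesh is
  geometric and \<beta> is the length of each interval relative to its left end.\<close>

lemma X_Suc: "X (Suc j) = X j * (1 + \<beta>)"
proof -
  define R where "R = real (r+1)"
  have "R > 0" by (simp add: R_def)
  then have "(real (Suc j) / real n - 1) / R = (real j / real n - 1) / R + 1 / (real n * R)"
    using n_pos by (simp add: field_simps)
  then show ?thesis by (simp only: mesh_pt_def one_plus_beta powr_add R_def)
qed

text \<open>Turns the Taylor bound for \<open>g\<close> at a mesh point into a power of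
  \<open>K\<close>; at \<open>j = 0\<close> the value is 1/K.\<close>

lemma X_power: "X j ^ (r+1) = K powr (real j / real n - 1)"
proof -
  have "X j ^ (r+1) = X j powr real (r+1)" using X_pos[of j] by (simp only: powr_realpow)
  also have "\<dots> = K powr (real j / real n - 1)"
    unfolding mesh_pt_def powr_powr by (simp del: of_nat_add of_nat_Suc)
  finally show ?thesis .
qed

lemma X_less: "X j < X (Suc j)"
  using X_pos[of j] beta_pos by (simp add: X_Suc)

lemma X_le_1: "j \<le> n \<Longrightarrow> X j \<le> 1"
  using Suc_chain_less[of n X j n] X_less X_n by (cases "j = n") auto

lemma beta_log: "ln (1 + \<beta>) * (real n * real (r+1)) = ln K"
  using K_gt_1 n_pos by (simp add: one_plus_beta ln_powr)

text \<open>The left side equals K^(1/n), and the lower bound on \<open>n\<close> enters here to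
  make it at most 2.\<close>

lemma one_plus_beta_power_le: "(1 + \<beta>) ^ (r+1) \<le> 2"
proof -
  have "ln ((1 + \<beta>) ^ (r+1)) = ln K / real n"
    using beta_log n_pos beta_pos
    by (subst ln_realpow) (auto simp: eq_divide_eq mult_ac simp del: of_nat_add)
  also have "\<dots> \<le> ln 2"
    using n_ge n_pos by (simp add: field_simps)
  finally show ?thesis using beta_pos by (simp del: power_Suc)
qed

text \<open>From \<beta>/(1 + \<beta>) \<le> ln (1 + \<beta>) and 1 + \<beta> \<le> 2 follows
  \<beta> \<le> 2 ln (1 + \<beta>). Summed over the mesh, the logarithms are at most
  \<open>ln K\<close>.\<close>

lemma n_beta_le: "real n * \<beta> \<le> 2 * ln K"
proof -
  have "1 + \<beta> \<le> (1 + \<beta>) ^ (r+1)" using beta_pos by (intro self_le_power) auto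
  then have le2: "1 + \<beta> \<le> 2" using one_plus_beta_power_le by linarith
  have "ln (1 / (1 + \<beta>)) \<le> 1 / (1 + \<beta>) - 1" using beta_pos by (intro ln_le_minus_one) auto
  then have "\<beta> / (1 + \<beta>) \<le> ln (1 + \<beta>)"
    using beta_pos by (simp add: ln_div field_simps)
  then have "\<beta> \<le> ln (1 + \<beta>) * (1 + \<beta>)" using beta_pos by (simp add: field_simps)
  also have "\<dots> \<le> ln (1 + \<beta>) * 2" using le2 beta_pos by (intro mult_left_mono) auto
  finally have "real n * \<beta> \<le> real n * (ln (1 + \<beta>) * 2)" by (intro mult_left_mono) auto
  also have "\<dots> \<le> 2 * (ln (1 + \<beta>) * (real n * real (r+1)))"
    using beta_pos by (simp add: algebra_simps)
  finally show ?thesis using beta_log by simp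
qed

text \<open>Indices are shifted here: quantities with argument \<open>Suc j\<close> belong to the
  mesh interval from \<open>X j\<close> to \<open>X (Suc j)\<close>, which avoids
  \<open>j - 1\<close> in the calculations.\<close>

context
  fixes m :: nat and j :: nat
  assumes m: "2 \<le> m" and j: "Suc j \<le> n"
begin

lemma mesh_cell: "0 < X j" "X j < X (Suc j)" "X (Suc j) \<le> 1" "0 < g (X j)"
  using X_pos X_less X_le_1[OF j] X_le_1[of j] j g_pos[of "X j"] by auto

lemma mesh_q_pos: "0 < mesh_q g r \<kappa> n (Suc j)"
  using mesh_cell g'_pos[of "X j"] by (simp add: mesh_q_def mesh_M_def less_max_iff_disj)

text \<open>The slope is at most (r + 1) \<sigma> X_{j+1}^r, and passing from the right end to the
  left end of the interval costs at most a factor 2. The lower bound \<delta> X_j^(r+1) for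
  \<open>g\<close> then cancels all powers of \<open>X j\<close>.\<close>

lemma mesh_q_le: "mesh_q g r \<kappa> n (Suc j) \<le> 2 * real (r+1) * \<sigma> / \<delta>"
proof -
  note c = mesh_cell
  let ?s = "real (r+1) * \<sigma>"
  have s: "0 \<le> ?s" using sigma_pos by simp
  have "X j ^ r \<le> X (Suc j) ^ r" using c by (intro power_mono) auto
  then have "?s * X j ^ r \<le> ?s * X (Suc j) ^ r" using s by (rule mult_left_mono)
  with g'_bounds(2)[of "X j"] c have "g' (X j) \<le> ?s * X (Suc j) ^ r" by (meson atLeastAtMost_iff less_imp_le order_trans)
  then have "\<bar>g' (X j)\<bar> \<le> ?s * X (Suc j) ^ r" "\<bar>g' (X (Suc j))\<bar> \<le> ?s * X (Suc j) ^ r"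
    using c g'_bounds(2)[of "X (Suc j)"] g'_pos[of "X j"] g'_pos[of "X (Suc j)"]
    by (auto simp del: of_nat_add)
  then have "mesh_M g r \<kappa> n (Suc j) \<le> ?s * X (Suc j) ^ r"
    by (simp add: mesh_M_def del: of_nat_add)
  also have "\<dots> = ?s * (1 + \<beta>) ^ r * X j ^ r" by (simp add: X_Suc power_mult_distrib)
  also have "\<dots> \<le> ?s * 2 * X j ^ r"
  proof -
    have "(1 + \<beta>) ^ r \<le> (1 + \<beta>) ^ (r+1)" using beta_pos by (intro power_increasing) auto
    then have "(1 + \<beta>) ^ r \<le> 2" using one_plus_beta_power_le by linarith
    then show ?thesis using s c by (intro mult_right_mono mult_left_mono) auto
  qed
  finally have "mesh_M g r \<kappa> n (Suc j) * X j \<le> ?s * 2 * X j ^ r * X j"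
    using c by (intro mult_right_mono) auto
  also have "\<dots> = (2 * ?s / \<delta>) * (\<delta> * X j ^ (r+1))"
    using delta_pos by (simp add: field_simps)
  also have "\<dots> \<le> (2 * ?s / \<delta>) * g (X j)"
    using g_bounds[of "X j"] c s delta_pos by (intro mult_left_mono) auto
  finally show ?thesis using c by (simp add: mesh_q_def pos_divide_le_eq mult_ac)
qed

lemma mesh_N_pos: "0 < mesh_N g r \<kappa> n m (Suc j)"
  using mesh_q_pos by (simp add: mesh_N_def)

lemma mesh_N_le:
  "int (mesh_N g r \<kappa> n m (Suc j)) \<le> \<lceil>(2 * real (r+1) * \<sigma> / \<delta>) powr (real m / (real m - 1))\<rceil>"
proof -
  have "\<lceil>mesh_q g r \<kappa> n (Suc j) powr (real m / (real m - 1))\<rceil>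
      \<le> \<lceil>(2 * real (r+1) * \<sigma> / \<delta>) powr (real m / (real m - 1))\<rceil>"
    using mesh_q_pos mesh_q_le m by (intro ceiling_mono powr_mono2) auto
  \<comment> \<open>Nonnegativity ensures that \<open>nat\<close> in \<open>mesh_N\<close> does not
    change the value of the ceiling.\<close>
  moreover have "0 \<le> \<lceil>mesh_q g r \<kappa> n (Suc j) powr (real m / (real m - 1))\<rceil>"
    using mesh_q_pos by (simp add: order_less_le_trans[of "-1" 0])
  ultimately show ?thesis by (simp add: mesh_N_def)
qed

text \<open>Explains the exponent m/(m - 1) in \<open>mesh_N\<close>: raising q^(m/(m-1)) \<le> N to
  the power m - 1 gives exactly the inequality that absorbs the N cells of a mesh interval.\<close>

lemma mesh_q_power_le: "mesh_q g r \<kappa> n (Suc j) ^ m \<le> real (mesh_N g r \<kappa> n m (Suc j)) ^ (m - 1)"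
proof -
  let ?q = "mesh_q g r \<kappa> n (Suc j)" and ?e = "real m / (real m - 1)"
  have "?q powr ?e \<le> real (mesh_N g r \<kappa> n m (Suc j))"
    unfolding mesh_N_def by linarith
  then have "(?q powr ?e) powr (real m - 1) \<le> real (mesh_N g r \<kappa> n m (Suc j)) powr (real m - 1)"
    using m by (intro powr_mono2) auto
  moreover have "(?q powr ?e) powr (real m - 1) = ?q ^ m"
    using m mesh_q_pos by (simp add: powr_powr powr_realpow)
  moreover have "real (mesh_N g r \<kappa> n m (Suc j)) powr (real m - 1) = real (mesh_N g r \<kappa> n m (Suc j)) ^ (m - 1)"
    using m mesh_N_pos powr_realpow[of "real (mesh_N g r \<kappa> n m (Suc j))" "m - 1"] by (simp add: of_nat_diff)
  ultimately show ?thesis by simp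
qed

end

section \<open>Counting the evaluations of \<Psi>\<close>

lemma num_evals_le:
  assumes "2 \<le> m" and T: "node_rule m T"
  shows "int (num_evals g T r \<kappa> n m)
      \<le> \<lceil>(2 * real (r+1) * \<sigma> / \<delta>) powr (real m / (real m - 1))\<rceil> * int n * int m + 1"
proof -
  let ?N = "\<lambda>j. mesh_N g r \<kappa> n m j"
  let ?y = "\<lambda>j. equi_pt (?N j) (X (j - 1)) (X j)"
  define W where "W j i = (\<lambda>l. g (T (?y j (i - 1)) (?y j i) l)) ` {0..m}" for j i
  define U where "U j = (\<Union>i\<in>{1..?N j}. W j i)" for j
  \<comment> \<open>A node rule includes both endpoints of its cell, so neighbouring cells share an
    evaluation point. The cell must first be shown to lie in (0,1], where the rule is
    constrained.\<close>
  have ends: "g (?y j (i - 1)) \<in> W j i" "g (?y j i) \<in> W j i"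
    if "1 \<le> j" "j \<le> n" "1 \<le> i" "i \<le> ?N j" for i j
  proof -
    define j' i' where "j' = j - 1" and "i' = i - 1"
    then have j': "j = Suc j'" "Suc j' \<le> n" and i': "i = Suc i'" using that by auto
    note c = mesh_cell[OF \<open>2 \<le> m\<close> j'(2)]
    have N: "0 < ?N j" using that by simp
    have "X j' \<le> ?y j i'"
      using equi_pt_mono[of "X j'" "X j" 0 i' "?N j"] c by (simp add: equi_pt_0 j')
    moreover have "?y j i \<le> X j"
      using equi_pt_mono[of "X j'" "X j" i "?N j" "?N j"] c that N by (simp add: equi_pt_N j')
    moreover have "?y j i' < ?y j i"
      using equi_pt_diff[OF N, of "X j'" "X j" i'] c N
      by (smt (verit) j'(1) i' diff_Suc_1 divide_pos_pos of_nat_0_less_iff)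
    ultimately have "0 < ?y j i'" "?y j i' < ?y j i" "?y j i \<le> 1"
      using c by (auto simp: j')
    then have "T (?y j i') (?y j i) 0 = ?y j i'" "T (?y j i') (?y j i) m = ?y j i"
      using T unfolding node_rule_def by blast+
    then show "g (?y j (i - 1)) \<in> W j i" "g (?y j i) \<in> W j i"
      unfolding W_def i' by (force intro!: image_eqI)+
  qed
  have card_U: "card (U j) \<le> ?N j * m + 1" if "1 \<le> j" "j \<le> n" for j
  proof -
    have "card (U j) \<le> (\<Sum>i=1..?N j. m) + 1"
      unfolding U_def
    proof (rule card_UN_chain)
      show "finite (W j i) \<and> card (W j i) \<le> m + 1" for i
        using card_image_le[of "{0..m}"] by (auto simp: W_def)
      show "W j i \<inter> W j (Suc i) \<noteq> {}" if "1 \<le> i" "i < ?N j" for i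
        using ends[of j i] ends[of j "Suc i"] that \<open>1 \<le> j\<close> \<open>j \<le> n\<close> by auto
    qed
    then show ?thesis by simp
  qed
  have "eval_points g T r \<kappa> n m = (\<Union>j\<in>{1..n}. U j)"
    by (simp add: eval_points_def U_def W_def Let_def)
  \<comment> \<open>Second use of the chain count, now over mesh intervals, which share the image of
    a mesh point. Thus a single extra 1 survives overall.\<close>
  also have "card \<dots> \<le> (\<Sum>j=1..n. ?N j * m) + 1"
  proof (rule card_UN_chain)
    show "finite (U j) \<and> card (U j) \<le> ?N j * m + 1" if "1 \<le> j" "j \<le> n" for j
      using card_U[OF that] by (auto simp: U_def W_def)
    show "U j \<inter> U (Suc j) \<noteq> {}" if "1 \<le> j" "j < n" for j
    proof -
      have N: "0 < ?N j" "0 < ?N (Suc j)"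
        using mesh_N_pos[OF \<open>2 \<le> m\<close>, of "j - 1"] mesh_N_pos[OF \<open>2 \<le> m\<close>, of j] that by auto
      have "g (X j) \<in> U j"
        unfolding U_def using ends(2)[of j "?N j"] that N by (force simp: equi_pt_N)
      moreover have "g (X j) \<in> U (Suc j)"
        unfolding U_def using ends(1)[of "Suc j" 1] that N by (force simp: equi_pt_0)
      ultimately show ?thesis by blast
    qed
  qed
  finally have "num_evals g T r \<kappa> n m \<le> (\<Sum>j=1..n. ?N j * m) + 1"
    by (simp add: num_evals_def)
  then have "int (num_evals g T r \<kappa> n m) \<le> int ((\<Sum>j=1..n. ?N j * m) + 1)"
    by (simp only: of_nat_le_iff)
  also have "\<dots> = (\<Sum>j=1..n. int (?N j) * int m) + 1"
    by simp
  also have "(\<Sum>j=1..n. int (?N j) * int m)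
      \<le> (\<Sum>j=1..n. \<lceil>(2 * real (r+1) * \<sigma> / \<delta>) powr (real m / (real m - 1))\<rceil> * int m)"
  proof (intro sum_mono mult_right_mono)
    fix j assume "j \<in> {1..n}"
    then show "int (?N j) \<le> \<lceil>(2 * real (r+1) * \<sigma> / \<delta>) powr (real m / (real m - 1))\<rceil>"
      using mesh_N_le[OF \<open>2 \<le> m\<close>, of "j - 1"] by simp
  qed simp
  finally show ?thesis by (simp add: mult_ac)
qed

end

subsection \<open>The error of the composite rule\<close>

locale filon_error = filon_mesh +
  fixes f :: "real \<Rightarrow> real" and m :: nat and \<alpha> C :: real and T :: "real \<Rightarrow> real \<Rightarrow> nat \<Rightarrow> real"
  assumes f_cont: "continuous_on {0<..1} f"
    and alpha: "\<alpha> < 1" and m: "2 \<le> m" and C_pos: "0 < C"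
    and Theta_smooth: "Ck_on (m+1) {0<..1} (Theta f g)"
    and Theta_bound: "\<And>y. y \<in> {0<..1} \<Longrightarrow>
      \<bar>nderiv_on {0<..1} (m+1) (Theta f g) y\<bar> \<le> C * y powr (\<alpha> - real (m+1))"
    and T: "node_rule m T"
begin

text \<open>These are the derivatives of \<Psi> given by the chain rule from \<Theta>(y) =
  \<Psi>(g(1) y). Defining them by rescaling transfers smoothness and the growth bound directly from
  \<open>Theta\<close>.\<close>

definition "Psi_deriv k x = nderiv_on {0<..1} k (Theta f g) (x / g 1) / g 1 ^ k"

lemma g1_pos: "0 < g 1"
  by (rule g_pos) auto

lemma g_le_g1: "0 \<le> x \<Longrightarrow> x \<le> 1 \<Longrightarrow> g x \<le> g 1"
  using mono_onD[OF mono_g, of x 1] by auto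

lemma Psi_deriv_0: "Psi_deriv 0 = Psi f g"
  using g1_pos by (auto simp: Psi_deriv_def nderiv_on_0 Theta_def fun_eq_iff)

lemma Psi_deriv_Suc:
  assumes "0 < a" "a \<le> x" "x \<le> b" "b \<le> g 1" "k \<le> m"
  shows "(Psi_deriv k has_real_derivative Psi_deriv (Suc k) x) (at x within {a..b})"
proof -
  let ?h = "nderiv_on {0<..1} k (Theta f g)" and ?h' = "nderiv_on {0<..1} (Suc k) (Theta f g)"
  have sub: "(\<lambda>x. x / g 1) ` {a..b} \<subseteq> {0<..1}"
  proof (intro image_subsetI)
    fix y assume "y \<in> {a..b}"
    then have "0 < y" "y \<le> g 1" using assms by auto
    then show "y / g 1 \<in> {0<..1}" using g1_pos by simp
  qed
  have "(?h has_real_derivative ?h' (x / g 1)) (at (x / g 1) within {0<..1})"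
    using assms sub by (intro nderiv_on_has_deriv[OF Theta_smooth]) auto
  then have "(?h has_real_derivative ?h' (x / g 1)) (at (x / g 1) within (\<lambda>x. x / g 1) ` {a..b})"
    by (rule DERIV_subset) (rule sub)
  then have "(?h \<circ> (\<lambda>x. x / g 1) has_real_derivative ?h' (x / g 1) * (1 / g 1)) (at x within {a..b})"
    by (rule DERIV_image_chain) (use g1_pos in \<open>auto intro!: derivative_eq_intros\<close>)
  from DERIV_cdivide[OF this, of "g 1 ^ k"] show ?thesis
    by (simp add: Psi_deriv_def[abs_def] o_def)
qed

text \<open>The exponent \<alpha> - (m + 1) is negative, so the bound is worst at the left end
  \<open>a\<close>. Of the powers of \<open>g 1\<close> produced by rescaling, only g(1)^(-\<alpha>)
  survives.\<close>

lemma Psi_deriv_bound: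
  assumes "0 < a" "a \<le> x" "x \<le> g 1"
  shows "\<bar>Psi_deriv (Suc m) x\<bar> \<le> C * g 1 powr (-\<alpha>) * a powr (\<alpha> - real (m+1))"
proof -
  let ?e = "\<alpha> - real (m+1)"
  have "\<bar>Psi_deriv (Suc m) x\<bar> = \<bar>nderiv_on {0<..1} (m+1) (Theta f g) (x / g 1)\<bar> / g 1 powr real (m+1)"
    using powr_realpow[OF g1_pos, of "m+1"] g1_pos by (simp add: Psi_deriv_def)
  also have "\<dots> \<le> C * (x / g 1) powr ?e / g 1 powr real (m+1)"
    using assms g1_pos by (intro divide_right_mono Theta_bound) auto
  also have "\<dots> = C * (x powr ?e / (g 1 powr ?e * g 1 powr real (m+1)))"
    using assms g1_pos by (simp add: powr_divide)
  also have "g 1 powr ?e * g 1 powr real (m+1) = g 1 powr \<alpha>"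
    by (simp flip: powr_add)
  also have "C * (x powr ?e / g 1 powr \<alpha>) = C * g 1 powr (-\<alpha>) * x powr ?e"
    by (simp add: powr_minus divide_simps)
  also have "\<dots> \<le> C * g 1 powr (-\<alpha>) * a powr ?e"
    using assms C_pos alpha by (intro mult_left_mono powr_mono2') auto
  finally show ?thesis .
qed

abbreviation "osc x \<equiv> complex_of_real (f x) * exp (\<i> * of_real (\<kappa> * g x))"

lemma osc_integrable:
  assumes "0 < a" "b \<le> 1"
  shows "osc integrable_on {a..b}"
proof (rule integrable_continuous_interval)
  have "continuous_on {a..b} f"
    by (rule continuous_on_subset[OF f_cont]) (use assms in auto)
  moreover have "continuous_on {a..b} g"
    by (rule continuous_on_subset[OF DERIV_continuous_on[OF g_deriv]]) (use assms in auto)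
  ultimately show "continuous_on {a..b} osc"
    by (intro continuous_intros)
qed

text \<open>The extra point \<open>c\<close> will be the left end of a whole mesh interval, so that
  all cells inside it share one bound on the top derivative.\<close>

lemma filon_cell_error:
  assumes "0 < c" "c \<le> a" "a < b" "b \<le> 1"
  shows "cmod (integral {a..b} osc - filon f g T \<kappa> m a b)
    \<le> 3 * (C * g 1 powr (-\<alpha>) * g c powr (\<alpha> - real (m+1))) * (g b - g a) ^ m / \<kappa> ^ 2"
proof -
  let ?F = "\<lambda>x. complex_of_real (Psi f g x) * exp (\<i> * of_real (\<kappa> * x))"
  have gc: "0 < g c" "g c \<le> g a" "0 < g a" "g a < g b" "g b \<le> g 1"
    using assms g_pos[of c] g_pos[of a] mono_onD[OF mono_g, of c a] g_less[of a b] g_le_g1[of b]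
    by auto
  have der: "(Psi_deriv k has_real_derivative Psi_deriv (Suc k) x) (at x within {g a..g b})"
    if "k \<le> m" "g a \<le> x" "x \<le> g b" for k x
    by (rule Psi_deriv_Suc) (use that gc in auto)
  have "integral {a..b} osc = integral {g a..g b} ?F"
  proof -
    \<comment> \<open>On the cell \<open>f\<close> equals g' times \<Psi> composed with
      \<open>g\<close>, so \<open>osc\<close> is precisely the integrand pulled back along
      \<open>g\<close>.\<close>
    have "((\<lambda>x. g' x *\<^sub>R ?F (g x)) has_integral integral {g a..g b} ?F) {a..b}"
    proof (rule has_integral_substitution)
      show "g ` {a..b} \<subseteq> {g a..g b}"
        using assms by (auto intro!: mono_onD[OF mono_g])
      have "continuous_on {g a..g b} (Psi f g)"
        using der[of 0] unfolding Psi_deriv_0[symmetric] by (auto intro!: DERIV_continuous_on)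
      then show "continuous_on {g a..g b} ?F" by (intro continuous_intros)
      show "(g has_real_derivative g' x) (at x within {a..b})" if "x \<in> {a..b}" for x
        by (rule DERIV_subset[OF g_deriv]) (use that assms in auto)
    qed (use gc assms in auto)
    moreover have "g' x *\<^sub>R ?F (g x) = osc x" if "x \<in> {a..b}" for x
      using Psi_g[of x f] g'_pos[of x] that assms by (simp add: scaleR_conv_of_real)
    ultimately have "(osc has_integral integral {g a..g b} ?F) {a..b}"
      by (rule has_integral_eq[rotated])
    then show ?thesis by (rule integral_unique)
  qed
  moreover have "cmod (integral {g a..g b} ?F - filon f g T \<kappa> m a b)
    \<le> 3 * (C * g 1 powr (-\<alpha>) * g c powr (\<alpha> - real (m+1))) * (g b - g a) ^ m / \<kappa> ^ 2"
    unfolding filon_def Let_def Psi_deriv_0[symmetric]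
  proof (rule interpolatory_quadrature_error)
    show "(Psi_deriv k has_real_derivative Psi_deriv (Suc k) x) (at x within {g a..g b})"
      if "k \<le> m" "g a \<le> x" "x \<le> g b" for k x
      by (rule der[OF that])
    show "\<bar>Psi_deriv (Suc m) x\<bar> \<le> C * g 1 powr (-\<alpha>) * g c powr (\<alpha> - real (m+1))"
      if "g a \<le> x" "x \<le> g b" for x
      by (rule Psi_deriv_bound) (use that gc in auto)
    have nodes: "T a b 0 = a" "T a b m = b" "\<And>j. j < m \<Longrightarrow> T a b j < T a b (Suc j)"
      using T assms unfolding node_rule_def by auto
    then show "g (T a b 0) = g a" "g (T a b m) = g b" by simp_all
    show "g (T a b j) < g (T a b (Suc j))" if "j < m" for j
    proof (rule g_less)
      have "a \<le> T a b j"
        using Suc_chain_less[of m "T a b" 0 j] nodes that by (cases "j = 0") auto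
      then show "0 \<le> T a b j" using assms by simp
      have "T a b (Suc j) \<le> b"
        using Suc_chain_less[of m "T a b" "Suc j" m] nodes that by (cases "Suc j = m") auto
      then show "T a b (Suc j) \<le> 1" using assms by simp
    qed (use nodes that in auto)
  qed (use gc kappa m in auto)
  ultimately show ?thesis by simp
qed

lemma filon_equi_error:
  assumes j: "Suc j \<le> n"
  shows "cmod (integral {X j..X (Suc j)} osc
      - filon_equi f g T (mesh_N g r \<kappa> n m (Suc j)) \<kappa> m (X j) (X (Suc j)))
    \<le> 3 * C * g 1 powr (-\<alpha>) * \<beta> ^ m * g (X j) powr (\<alpha> - 1) / \<kappa> ^ 2"
proof -
  define N where "N = mesh_N g r \<kappa> n m (Suc j)"
  define q where "q = mesh_q g r \<kappa> n (Suc j)"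
  define y where "y = equi_pt N (X j) (X (Suc j))"
  define L where "L = C * g 1 powr (-\<alpha>) * g (X j) powr (\<alpha> - real (m+1))"
  note c = mesh_cell[OF m j]
  have N: "0 < N" unfolding N_def by (rule mesh_N_pos[OF m j])
  have q: "0 < q" unfolding q_def by (rule mesh_q_pos[OF m j])
  have L: "0 \<le> L" using C_pos by (simp add: L_def)
  have y_ends: "y 0 = X j" "y N = X (Suc j)"
    using N by (simp_all add: y_def equi_pt_0 equi_pt_N)
  have y_diff: "y (Suc i) - y i = X j * \<beta> / real N" for i
    using N by (simp add: y_def equi_pt_diff X_Suc algebra_simps)
  have y_less: "y i < y (Suc i)" for i
    using y_diff[of i] N c beta_pos by (smt (verit) divide_pos_pos mult_pos_pos of_nat_0_less_iff)
  \<comment> \<open>The image of a cell under \<open>g\<close> has length at most the slope bound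
    \<open>mesh_M\<close> times X_j \<beta>/N; by definition of \<open>q\<close> this product is q
    g(X_j) \<beta>/N.\<close>
  have cell: "cmod (integral {y (i - 1)..y i} osc - filon f g T \<kappa> m (y (i - 1)) (y i))
      \<le> 3 * L * (q * g (X j) * \<beta> / real N) ^ m / \<kappa> ^ 2" if "i \<in> {1..N}" for i
  proof -
    define i' where "i' = i - 1"
    then have i: "i = Suc i'" "Suc i' \<le> N" using that by auto
    have lo: "X j \<le> y i'"
      using equi_pt_mono[of "X j" "X (Suc j)" 0 i' N] c by (simp add: y_def equi_pt_0)
    have hi: "y (Suc i') \<le> X (Suc j)"
      using equi_pt_mono[of "X j" "X (Suc j)" "Suc i'" N N] c i N by (simp add: y_def equi_pt_N)
    have "g (y (Suc i')) - g (y i') \<le> mesh_M g r \<kappa> n (Suc j) * (X j * \<beta> / real N)"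
      using g_diff_le[of "X j" "y i'" "y (Suc i')" "X (Suc j)"] c lo hi y_less[of i']
      unfolding y_diff by (simp add: mesh_M_def)
    also have "\<dots> = q * g (X j) * \<beta> / real N"
      using c by (simp add: q_def mesh_q_def)
    finally have "g (y (Suc i')) - g (y i') \<le> q * g (X j) * \<beta> / real N" .
    moreover have "g (y i') < g (y (Suc i'))"
      using g_less[of "y i'" "y (Suc i')"] lo hi c y_less[of i'] by auto
    ultimately have "(g (y (Suc i')) - g (y i')) ^ m \<le> (q * g (X j) * \<beta> / real N) ^ m"
      by (intro power_mono) auto
    then have "3 * L * (g (y (Suc i')) - g (y i')) ^ m / \<kappa> ^ 2
        \<le> 3 * L * (q * g (X j) * \<beta> / real N) ^ m / \<kappa> ^ 2"
      using L by (intro divide_right_mono mult_left_mono) auto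
    then show ?thesis
      using filon_cell_error[of "X j" "y i'" "y (Suc i')"] c lo hi y_less[of i'] i
      unfolding L_def by auto
  qed
  have "integral {X j..X (Suc j)} osc = (\<Sum>i=1..N. integral {y (i - 1)..y i} osc)"
    using integral_sum_mesh[of osc y N] osc_integrable[of "X j" "X (Suc j)"] c y_less
    by (auto simp: y_ends less_imp_le)
  then have "cmod (integral {X j..X (Suc j)} osc - filon_equi f g T N \<kappa> m (X j) (X (Suc j)))
      = cmod (\<Sum>i=1..N. integral {y (i - 1)..y i} osc - filon f g T \<kappa> m (y (i - 1)) (y i))"
    by (simp add: filon_equi_def y_def sum_subtractf)
  also have "\<dots> \<le> (\<Sum>i=1..N. 3 * L * (q * g (X j) * \<beta> / real N) ^ m / \<kappa> ^ 2)"
    by (rule sum_norm_le) (rule cell)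
  also have "\<dots> = 3 * L * (g (X j) * \<beta>) ^ m * (real N * q ^ m / real N ^ m) / \<kappa> ^ 2"
    by (simp add: power_mult_distrib power_divide mult_ac)
  \<comment> \<open>The choice of \<open>N\<close> makes N (q/N)^m \<le> 1, so subdividing leaves no
    trace of \<open>q\<close> or \<open>N\<close> in the bound.\<close>
  also have "\<dots> \<le> 3 * L * (g (X j) * \<beta>) ^ m * 1 / \<kappa> ^ 2"
  proof -
    have "real N * q ^ m \<le> real N * real N ^ (m - 1)"
      using mesh_q_power_le[OF m j] by (intro mult_left_mono) (auto simp: q_def N_def)
    also have "\<dots> = real N ^ m" using m by (simp add: power_eq_if)
    finally have "real N * q ^ m / real N ^ m \<le> 1" using N by simp
    then show ?thesis
      using L c beta_pos by (intro divide_right_mono mult_left_mono) auto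
  qed
  also have "\<dots> = 3 * C * g 1 powr (-\<alpha>) * \<beta> ^ m
      * (g (X j) powr (\<alpha> - real (m+1)) * g (X j) ^ m) / \<kappa> ^ 2"
    by (simp add: L_def power_mult_distrib mult_ac)
  also have "g (X j) powr (\<alpha> - real (m+1)) * g (X j) ^ m = g (X j) powr (\<alpha> - 1)"
    using c by (simp add: powr_realpow[symmetric] flip: powr_add)
  finally show ?thesis unfolding N_def .
qed

lemma filon_Lambda_error:
  "cmod (osc_integral f g r \<kappa> - filon_Lambda f g T r \<kappa> n m)
    \<le> 6 * C * real (r+1) * \<bar>g 1\<bar> powr (-\<alpha>) * \<delta> powr (\<alpha> - 1)
      * \<kappa> powr (-2) * K powr (1 - \<alpha>) * ln K * \<beta> ^ (m - 1)"
proof -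
  \<comment> \<open>Collects the factors that are the same for every mesh interval.\<close>
  define D where "D = C * g 1 powr (-\<alpha>) * \<delta> powr (\<alpha> - 1) * K powr (1 - \<alpha>) / \<kappa> ^ 2"
  have D: "0 \<le> D" using C_pos by (simp add: D_def)
  have cell: "cmod (integral {X (j - 1)..X j} osc
      - filon_equi f g T (mesh_N g r \<kappa> n m j) \<kappa> m (X (j - 1)) (X j))
      \<le> 3 * D * \<beta> ^ m" if "j \<in> {1..n}" for j
  proof -
    define i where "i = j - 1"
    then have j: "j = Suc i" "Suc i \<le> n" using that by auto
    note c = mesh_cell[OF m j(2)]
    \<comment> \<open>The exponent is negative, so the lower bound for \<open>g\<close> gives an
      upper bound. The resulting power of \<open>K\<close> is largest at the leftmost mesh point,
      \<open>i = 0\<close>, which yields K^(1-\<alpha>).\<close>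
    have "g (X i) powr (\<alpha> - 1) \<le> (\<delta> * X i ^ (r+1)) powr (\<alpha> - 1)"
      using g_bounds[of "X i"] c delta_pos alpha by (intro powr_mono2') auto
    also have "\<dots> = \<delta> powr (\<alpha> - 1) * K powr ((real i / real n - 1) * (\<alpha> - 1))"
      using delta_pos c K_gt_1 unfolding X_power by (simp add: powr_mult powr_powr)
    also have "\<dots> \<le> \<delta> powr (\<alpha> - 1) * K powr (1 - \<alpha>)"
    proof -
      have "real i / real n * (\<alpha> - 1) \<le> 0"
        using alpha by (intro mult_nonneg_nonpos) auto
      then have "(real i / real n - 1) * (\<alpha> - 1) \<le> 1 - \<alpha>" by (simp add: algebra_simps)
      then show ?thesis using K_gt_1 by (intro mult_left_mono powr_mono) auto
    qed
    finally have "3 * C * g 1 powr (-\<alpha>) * \<beta> ^ m * g (X i) powr (\<alpha> - 1) / \<kappa> ^ 2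
        \<le> 3 * C * g 1 powr (-\<alpha>) * \<beta> ^ m * (\<delta> powr (\<alpha> - 1) * K powr (1 - \<alpha>)) / \<kappa> ^ 2"
      using C_pos beta_pos by (intro divide_right_mono mult_left_mono) auto
    also have "\<dots> = 3 * D * \<beta> ^ m" by (simp add: D_def mult_ac)
    finally show ?thesis using filon_equi_error[OF j(2)] j by simp
  qed
  have "osc_integral f g r \<kappa> = integral {X 0..X n} osc"
    by (simp add: osc_integral_def X_0 X_n)
  also have "\<dots> = (\<Sum>j=1..n. integral {X (j - 1)..X j} osc)"
    using integral_sum_mesh[of osc X n] osc_integrable[of "X 0" "X n"] X_pos X_less X_n
    by (auto simp: less_imp_le)
  finally have "cmod (osc_integral f g r \<kappa> - filon_Lambda f g T r \<kappa> n m)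
      = cmod (\<Sum>j=1..n. integral {X (j - 1)..X j} osc
          - filon_equi f g T (mesh_N g r \<kappa> n m j) \<kappa> m (X (j - 1)) (X j))"
    by (simp add: filon_Lambda_def sum_subtractf)
  also have "\<dots> \<le> (\<Sum>j=1..n. 3 * D * \<beta> ^ m)"
    by (rule sum_norm_le) (rule cell)
  \<comment> \<open>One factor \<beta> is split off to pair with the number \<open>n\<close> of
    intervals. Their product is at most 2 \<open>ln K\<close>, which turns the constant 3 into
    6.\<close>
  also have "\<dots> = 3 * D * \<beta> ^ (m - 1) * (real n * \<beta>)"
    using m by (simp add: power_eq_if)
  also have "\<dots> \<le> 3 * D * \<beta> ^ (m - 1) * (2 * ln K)"
    using D beta_pos n_beta_le by (intro mult_left_mono) auto
  also have "\<dots> \<le> 3 * D * \<beta> ^ (m - 1) * (2 * ln K) * real (r+1)"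
    using D beta_pos K_gt_1 mult_left_mono[of 1 "real (r+1)" "3 * D * \<beta> ^ (m - 1) * (2 * ln K)"] by simp
  also have "\<dots> = 6 * C * real (r+1) * \<bar>g 1\<bar> powr (-\<alpha>) * \<delta> powr (\<alpha> - 1)
      * \<kappa> powr (-2) * K powr (1 - \<alpha>) * ln K * \<beta> ^ (m - 1)"
  proof -
    have "\<kappa> powr (-2) = 1 / \<kappa> ^ 2"
      using kappa by (simp add: powr_minus powr_realpow[of \<kappa> 2, simplified] field_simps)
    then show ?thesis using g1_pos by (simp add: D_def mult_ac)
  qed
  finally show ?thesis .
qed

end

section \<open>Assembling the error bound and the evaluation count\<close>

theorem theorem4p10:
  fixes f g :: "real \<Rightarrow> real" and r m :: nat and \<alpha> :: real
  assumes "r > 0"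
    and "Ck_on (r+1) {0..1} g"
    and "\<And>j. j \<le> r \<Longrightarrow> nderiv_on {0..1} j g 0 = 0"
    and "\<And>x. x \<in> {0..1} \<Longrightarrow> nderiv_on {0..1} (r+1) g x \<noteq> 0"
    and "mono_on {0..1} g"
    and "mono_on {0..1} (nderiv_on {0..1} 1 g) \<or> antimono_on {0..1} (nderiv_on {0..1} 1 g)"
    and "f absolutely_integrable_on {0..1}"
    and "continuous_on {0<..1} f"
    and "-1 < \<alpha>" and "\<alpha> < 1"
    and "m \<ge> 2"
    and "Type0 \<alpha> (m+1) (Theta f g)"
  shows "(\<exists>c>0. \<forall>\<kappa>>1. \<forall>n\<ge>1. real n \<ge> ln (kappa_sigma g r \<kappa>) / ln 2 \<longrightarrow>
            (\<forall>T. node_rule m T \<longrightarrow>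
               cmod (osc_integral f g r \<kappa> - filon_Lambda f g T r \<kappa> n m)
                 \<le> c * real (r+1) * \<bar>g 1\<bar> powr (-\<alpha>) * delta_min g r powr (\<alpha> - 1)
                     * \<kappa> powr (-2) * kappa_sigma g r \<kappa> powr (1 - \<alpha>)
                     * ln (kappa_sigma g r \<kappa>) * beta_n g r \<kappa> n ^ (m - 1)))
       \<and> (\<forall>\<kappa>>1. \<forall>n\<ge>1. real n \<ge> ln (kappa_sigma g r \<kappa>) / ln 2 \<longrightarrow>
            (\<forall>T. node_rule m T \<longrightarrow>
               int (num_evals g T r \<kappa> n m)
                 \<le> \<lceil>(2 * real (r+1) * sigma_max g r / delta_min g r)
                        powr (real m / (real m - 1))\<rceil> * int n * int m + 1))"
proof -
  interpret flat_phase g r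
    by standard (use assms in auto)
  have mesh: "filon_mesh g r \<kappa> n"
    if "1 < \<kappa>" "1 \<le> n" "ln (kappa_sigma g r \<kappa>) / ln 2 \<le> real n" for \<kappa> n
    by standard (use that in auto)
  \<comment> \<open>\<open>C\<close> depends only on \<open>Theta\<close> and is fixed before
    \<kappa>, \<open>n\<close> and the node rule, so the witness \<open>6 * C\<close> is uniform in
    them.\<close>
  obtain C where C: "0 < C" "\<And>y. y \<in> {0<..1} \<Longrightarrow>
      \<bar>nderiv_on {0<..1} (m+1) (Theta f g) y\<bar> \<le> C * y powr (\<alpha> - real (m+1))"
    using assms(12) unfolding Type0_def by blast
  have "filon_error g r \<kappa> n f m \<alpha> C T"
    if "1 < \<kappa>" "1 \<le> n" "ln (kappa_sigma g r \<kappa>) / ln 2 \<le> real n" "node_rule m T" for \<kappa> n T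
    using mesh[OF that(1-3)] assms C that(4)
    by (intro filon_error.intro filon_error_axioms.intro) (auto simp: Type0_def)
  from filon_error.filon_Lambda_error[OF this] filon_mesh.num_evals_le[OF mesh assms(11)] C(1)
  show ?thesis
    by (intro conjI exI[of _ "6 * C"]) auto
qed

end
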